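(* Let $K$ be a pathwise connected poset, $G$ a group, $\mathcal{P}\in\mathscr{P}(K,G)$ a principal net bundle over $K$ with structure group $G$ and total space $P$, let $\psi\in P$, and let $U$ be a connection on $\mathcal{P}$ with holonomy group $H_U(\psi)\subseteq G$. Then: (i) $\mathcal{P}$ is reducible to a principal net bundle $\tilde{\mathcal{P}}\in\mathscr{P}(K,H_U(\psi))$; (ii) $U$ is reducible to a connection $\tilde U$ on $\tilde{\mathcal{P}}$.
   Context: Simplices of a poset $K$: $\tilde\Sigma_n(K)$ is the set of order-preserving maps from the poset of non-empty subsets of $\{0,\dots,n\}$ to $K$. So $\tilde\Sigma_0(K)=K$; a $1$-simplex $b=(|b|;\partial_0b,\partial_1b)$ has $\partial_0b,\partial_1b\le|b|$; a $2$-simplex $c$ consists of a support $|c|$ and $1$-simplices $\partial_0c,\partial_1c,\partial_2c$ with $|\partial_ic|\le|c|$, $\partial_0\partial_0c=\partial_0\partial_1c$, $\partial_1\partial_0c=\partial_0\partial_2c$, $\partial_1\partial_1c=\partial_1\partial_2c$. Reverse: $\overline b=(|b|;\partial_1b,\partial_0b)$; $\sigma_0a=(a;a,a)$. Nerve: $\Sigma_1(K)$ consists of pairs $(a,\tilde a)$ with $\tilde a\le a$, $0$-face $a$, $1$-face $\tilde a$, identified with $(a;a,\tilde a)$; $\Sigma_2(K)\subseteq\tilde\Sigma_2(K)$ consists of chains $v_0\le v_1\le v_2$ with $\partial_0c=(v_2,v_1)$, $\partial_1c=(v_2,v_0)$, $\partial_2c=(v_1,v_0)$, $|c|=v_2$.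 A path is $p=b_n*\cdots*b_1$, $b_i\in\tilde\Sigma_1(K)$, $\partial_0b_i=\partial_1b_{i+1}$; $\partial_1p=\partial_1b_1$, $\partial_0p=\partial_0b_n$. $K$ is pathwise connected if any two elements are joined by a path. Principal net bundle $\mathcal{P}\in\mathscr{P}(K,G)$: a set $P$, a surjection $\pi:P\to K$, bijections $J_b:\pi^{-1}(\partial_1b)\to\pi^{-1}(\partial_0b)$, $b\in\Sigma_1(K)$, with $J_{\partial_0c}J_{\partial_2c}=J_{\partial_1c}$ ($c\in\Sigma_2(K)$), $J_{\sigma_0a}=\mathrm{id}$, and a free right $G$-action on $P$ preserving the fibres, transitive on each fibre, commuting with $J$. A morphism $\hat{\mathcal{P}}\to\mathcal{P}$ is a $G$-equivariant map $f:\hat P\to P$ with $\pi f=\hat\pi$, $Jf=f\hat J$. Connection $U$ on $\mathcal{P}$: $G$-equivariant bijections $U(b):\pi^{-1}(\partial_1b)\to\pi^{-1}(\partial_0b)$, $b\in\tilde\Sigma_1(K)$, with $U(\overline b)=U(b)^{-1}$ and $U(b)=J_b$ for $b\in\Sigma_1(K)$; $U(p):=U(b_n)\cdots U(b_1)$ for a path $p=b_n*\cdots*b_1$. Flat: $U(\partial_0c)U(\partial_2c)=U(\partial_1c)$ for $c\in\tilde\Sigma_2(K)$. Each $\mathcal{P}$ has a unique flat connection, $Z(b)=J^{-1}_{(|b|,\partial_0b)}J_{(|b|,\partial_1b)}$. For connections $\hat U$ on $\hat{\mathcal{P}}$, $U$ on $\mathcal{P}$ (same structure group), $\hat U\cong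 U$ means there is a morphism $f:\hat{\mathcal{P}}\to\mathcal{P}$ with $f\hat U(b)=U(b)f$ for all $b$. Holonomy group: $H_U(\psi)=\{g\in G: \psi\cdot g=U(p)\psi \text{ for some path } p \text{ with } \partial_0p=\pi(\psi)=\partial_1p\}$; it is a subgroup of $G$. Local trivialization and cochains: let $V_a=\{o\in K:a\le o\}$. A local trivialization $\theta=\{\theta_a\}_{a\in K}$ of $\mathcal{P}$ is a family of bijections $\theta_a:V_a\times G\to\pi^{-1}(V_a)$ with $\pi\theta_a(o,g)=o$, $\theta_a(o,gh)=\theta_a(o,g)\cdot h$ and $J_b\theta_a(\partial_1b,g)=\theta_a(\partial_0b,g)$ for $1$-simplices $b$ of the nerve of $V_a$. For a connection $U$, the connection cochain $u_\theta=\Gamma_\theta(U):\tilde\Sigma_1(K)\to G$ is defined by $(\partial_0b,\Gamma_\theta(U)(b)g)=\theta_{\partial_0b}^{-1}U(b)\theta_{\partial_1b}(\partial_1b,g)$; the bundle cocycle is $z_\theta=\Gamma_\theta(Z)$, which agrees with $u_\theta$ on $\Sigma_1(K)$. Reconstruction: for a $1$-cocycle $z$ with values in $G$ (a map $z:\tilde\Sigma_1(K)\to G$ with $z(\partial_0c)z(\partial_2c)=z(\partial_1c)$ for $c\in\tilde\Sigma_2(K)$), $\mathcal{P}_z\in\mathscr{P}(K,G)$ is the set of classes $[o,g,a]$ ($a\in K$, $o\in V_a$, $g\in G$) under $(o,g,a)\sim(o_1,g_1,a_1)\iff o=o_1\in V_a\cap V_{a_1}$ and $g=z(o;a,a_1)g_1$,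 with $\pi[o,g,a]=o$, $J_b[\partial_1b,g,a]=[\partial_0b,g,a]$, $[o,g,a]\cdot h=[o,gh,a]$; it has the local trivialization $(\theta_z)_a(o,g)=[o,g,a]$. If $u:\tilde\Sigma_1(K)\to G$ satisfies $u(\overline b)=u(b)^{-1}$ and $u=z$ on $\Sigma_1(K)$, then $\Upsilon_{\theta_z}(u)$ is the connection on $\mathcal{P}_z$ defined by $\Upsilon_{\theta_z}(u)(b)(\theta_z)_{\partial_1b}(\partial_1b,g)=(\theta_z)_{\partial_0b}(\partial_0b,u(b)g)$. Reducibility: let $H\subseteq G$ be a subgroup with inclusion $\iota_{G,H}$, $\tilde{\mathcal{P}}\in\mathscr{P}(K,H)$ and $\tilde U$ a connection on $\tilde{\mathcal{P}}$. A connection $U$ on $\mathcal{P}\in\mathscr{P}(K,G)$ is reducible to $\tilde U$ if, for a local trivialization $\phi$ of $\tilde{\mathcal{P}}$, $\Upsilon_{\theta_{\tilde z_\phi}}(\iota_{G,H}\circ\Gamma_\phi(\tilde U))\cong U$, where $\tilde z_\phi$ is the bundle cocycle of $\tilde{\mathcal{P}}$ regarded as having values in $G$ (this does not depend on $\phi$). The bundle $\mathcal{P}$ is reducible to $\tilde{\mathcal{P}}$ if its flat connection is reducible to a connection on $\tilde{\mathcal{P}}$. *)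

theory Defs
  imports "HOL-Algebra.Algebra"
begin

section \<open>Simplices and paths of a poset\<close>

text \<open>The poset \<open>K\<close> is a type of class \<^class>\<open>order\<close>. An order-preserving map from the non-empty
  subsets of \<open>{0,1}\<close> to \<open>K\<close> is given by its value \<open>supp\<close> on \<open>{0,1}\<close> and by the vertices
  \<open>face0\<close> (its value on \<open>{1}\<close>) and \<open>face1\<close> (its value on \<open>{0}\<close>). One on the non-empty subsets
  of \<open>{0,1,2}\<close> is given by its value \<open>supp2\<close> on \<open>{0,1,2}\<close> and its three faces.\<close>

datatype 'k simplex1 = Simplex1 (supp: 'k) (face0: 'k) (face1: 'k)

datatype 'k simplex2 =
  Simplex2 (supp2: 'k) (d0: "'k simplex1") (d1: "'k simplex1") (d2: "'k simplex1")

definition Sing1 :: "'k::order simplex1 set" where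
  "Sing1 = {b. face0 b \<le> supp b \<and> face1 b \<le> supp b}"

definition Sing2 :: "'k::order simplex2 set" where
  "Sing2 = {c. d0 c \<in> Sing1 \<and> d1 c \<in> Sing1 \<and> d2 c \<in> Sing1 \<and>
     supp (d0 c) \<le> supp2 c \<and> supp (d1 c) \<le> supp2 c \<and> supp (d2 c) \<le> supp2 c \<and>
     face0 (d0 c) = face0 (d1 c) \<and> face1 (d0 c) = face0 (d2 c) \<and> face1 (d1 c) = face1 (d2 c)}"

definition reverse1 :: "'k simplex1 \<Rightarrow> 'k simplex1" where
  "reverse1 b = Simplex1 (supp b) (face1 b) (face0 b)"

definition degen :: "'k \<Rightarrow> 'k simplex1" where
  "degen a = Simplex1 a a a"

text \<open>The nerve pair \<open>(a, a')\<close> with \<open>a' \<le> a\<close>, identified with the 1-simplex \<open>(a; a, a')\<close>.\<close>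

definition nerve_pair :: "'k \<Rightarrow> 'k \<Rightarrow> 'k simplex1" where
  "nerve_pair a a' = Simplex1 a a a'"

definition Nerve1 :: "'k::order simplex1 set" where
  "Nerve1 = {nerve_pair a a' | a a'. a' \<le> a}"

definition Nerve2 :: "'k::order simplex2 set" where
  "Nerve2 = {Simplex2 v2 (nerve_pair v2 v1) (nerve_pair v2 v0) (nerve_pair v1 v0) | v0 v1 v2.
     v0 \<le> v1 \<and> v1 \<le> v2}"

text \<open>The path \<open>b\<^sub>n * \<dots> * b\<^sub>1\<close> is the list \<open>[b\<^sub>1, \<dots>, b\<^sub>n]\<close>, in the order of traversal.\<close>

definition is_path :: "'k::order simplex1 list \<Rightarrow> bool" where
  "is_path p \<longleftrightarrow> p \<noteq> [] \<and> set p \<subseteq> Sing1 \<and>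
     (\<forall>i. Suc i < length p \<longrightarrow> face0 (p ! i) = face1 (p ! Suc i))"

definition path_source :: "'k simplex1 list \<Rightarrow> 'k" where
  "path_source p = face1 (hd p)"

definition path_target :: "'k simplex1 list \<Rightarrow> 'k" where
  "path_target p = face0 (last p)"

definition pathwise_connected :: "'k::order itself \<Rightarrow> bool" where
  "pathwise_connected _ \<longleftrightarrow>
     (\<forall>a a'::'k. \<exists>p. is_path p \<and> path_source p = a \<and> path_target p = a')"

section \<open>Principal net bundles\<close>

record ('k, 'g, 'p) net_bundle =
  total_space :: "'p set"
  proj :: "'p \<Rightarrow> 'k"
  J :: "'k simplex1 \<Rightarrow> 'p \<Rightarrow> 'p"
  act :: "'p \<Rightarrow> 'g \<Rightarrow> 'p"

definition fibre :: "('k, 'g, 'p) net_bundle \<Rightarrow> 'k \<Rightarrow> 'p set" where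
  "fibre P a = {x \<in> total_space P. proj P x = a}"

locale principal_net_bundle = group G
  for G :: "('g, 'm) monoid_scheme" (structure) +
  fixes P :: "('k::order, 'g, 'p) net_bundle"
  assumes proj_surj: "proj P ` total_space P = UNIV"
    and J_bij: "b \<in> Nerve1 \<Longrightarrow> bij_betw (J P b) (fibre P (face1 b)) (fibre P (face0 b))"
    and J_comp: "\<lbrakk>c \<in> Nerve2; x \<in> fibre P (face1 (d1 c))\<rbrakk>
      \<Longrightarrow> J P (d0 c) (J P (d2 c) x) = J P (d1 c) x"
    and J_degen: "x \<in> fibre P a \<Longrightarrow> J P (degen a) x = x"
    and act_closed: "\<lbrakk>x \<in> total_space P; g \<in> carrier G\<rbrakk> \<Longrightarrow> act P x g \<in> total_space P"
    and act_one: "x \<in> total_space P \<Longrightarrow> act P x \<one> = x"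
    and act_mult: "\<lbrakk>x \<in> total_space P; g \<in> carrier G; h \<in> carrier G\<rbrakk>
      \<Longrightarrow> act P x (g \<otimes> h) = act P (act P x g) h"
    and act_free: "\<lbrakk>x \<in> total_space P; g \<in> carrier G; act P x g = x\<rbrakk> \<Longrightarrow> g = \<one>"
    and act_fibre: "\<lbrakk>x \<in> total_space P; g \<in> carrier G\<rbrakk> \<Longrightarrow> proj P (act P x g) = proj P x"
    and act_transitive: "\<lbrakk>x \<in> total_space P; y \<in> total_space P; proj P x = proj P y\<rbrakk>
      \<Longrightarrow> \<exists>g \<in> carrier G. y = act P x g"
    and J_act: "\<lbrakk>b \<in> Nerve1; x \<in> fibre P (face1 b); g \<in> carrier G\<rbrakk>
      \<Longrightarrow> J P b (act P x g) = act P (J P b x) g"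

definition bundle_morphism ::
  "('g, 'm) monoid_scheme \<Rightarrow> ('k::order, 'g, 'q) net_bundle \<Rightarrow> ('k, 'g, 'p) net_bundle
     \<Rightarrow> ('q \<Rightarrow> 'p) \<Rightarrow> bool" where
  "bundle_morphism G Q P f \<longleftrightarrow>
     f \<in> total_space Q \<rightarrow> total_space P \<and>
     (\<forall>x \<in> total_space Q. \<forall>g \<in> carrier G. f (act Q x g) = act P (f x) g) \<and>
     (\<forall>x \<in> total_space Q. proj P (f x) = proj Q x) \<and>
     (\<forall>b \<in> Nerve1. \<forall>x \<in> fibre Q (face1 b). J P b (f x) = f (J Q b x))"

section \<open>Connections and holonomy\<close>

definition bundle_connection ::
  "('g, 'm) monoid_scheme \<Rightarrow> ('k::order, 'g, 'p) net_bundle \<Rightarrow> ('k simplex1 \<Rightarrow> 'p \<Rightarrow> 'p) \<Rightarrow> bool"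
  where
  "bundle_connection G P U \<longleftrightarrow>
     (\<forall>b \<in> Sing1. bij_betw (U b) (fibre P (face1 b)) (fibre P (face0 b))) \<and>
     (\<forall>b \<in> Sing1. \<forall>x \<in> fibre P (face1 b). \<forall>g \<in> carrier G. U b (act P x g) = act P (U b x) g) \<and>
     (\<forall>b \<in> Sing1. \<forall>x \<in> fibre P (face0 b).
        U (reverse1 b) x = inv_into (fibre P (face1 b)) (U b) x) \<and>
     (\<forall>b \<in> Nerve1. \<forall>x \<in> fibre P (face1 b). U b x = J P b x)"

definition path_transport :: "('k simplex1 \<Rightarrow> 'p \<Rightarrow> 'p) \<Rightarrow> 'k simplex1 list \<Rightarrow> 'p \<Rightarrow> 'p" where
  "path_transport U p = fold U p"

definition holonomy_group ::
  "('g, 'm) monoid_scheme \<Rightarrow> ('k::order, 'g, 'p) net_bundle \<Rightarrow> ('k simplex1 \<Rightarrow> 'p \<Rightarrow> 'p)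
     \<Rightarrow> 'p \<Rightarrow> 'g set" where
  "holonomy_group G P U \<psi> = {g \<in> carrier G. \<exists>p. is_path p \<and>
     path_target p = proj P \<psi> \<and> path_source p = proj P \<psi> \<and> act P \<psi> g = path_transport U p \<psi>}"

definition flat :: "('k::order, 'g, 'p) net_bundle \<Rightarrow> ('k simplex1 \<Rightarrow> 'p \<Rightarrow> 'p) \<Rightarrow> bool" where
  "flat P U \<longleftrightarrow> (\<forall>c \<in> Sing2. \<forall>x \<in> fibre P (face1 (d1 c)). U (d0 c) (U (d2 c) x) = U (d1 c) x)"

text \<open>The formula \<open>Z(b) = J(|b|, \<partial>\<^sub>0 b)\<^sup>-\<^sup>1 J(|b|, \<partial>\<^sub>1 b)\<close>; the lemmas below show that it is the unique
  flat connection.\<close>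

definition flat_connection :: "('k, 'g, 'p) net_bundle \<Rightarrow> 'k simplex1 \<Rightarrow> 'p \<Rightarrow> 'p" where
  "flat_connection P b x =
     inv_into (fibre P (face0 b)) (J P (nerve_pair (supp b) (face0 b)))
       (J P (nerve_pair (supp b) (face1 b)) x)"

context principal_net_bundle
begin

lemma J_pair_bij:
  assumes "a \<le> x"
  shows "bij_betw (J P (nerve_pair x a)) (fibre P a) (fibre P x)"
  using J_bij[of "nerve_pair x a"] assms by (auto simp: Nerve1_def nerve_pair_def)

lemma J_pair_comp:
  assumes "a \<le> x" "x \<le> y" "p \<in> fibre P a"
  shows "J P (nerve_pair y x) (J P (nerve_pair x a) p) = J P (nerve_pair y a) p"
  using J_comp[of "Simplex2 y (nerve_pair y x) (nerve_pair y a) (nerve_pair x a)" p] assms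
  by (auto simp: Nerve2_def nerve_pair_def)

lemma flat_connection_eqI:
  assumes "b \<in> Sing1" "supp b \<le> x" "p \<in> fibre P (face1 b)" "q \<in> fibre P (face0 b)"
    and "J P (nerve_pair x (face0 b)) q = J P (nerve_pair x (face1 b)) p"
  shows "flat_connection P b p = q"
proof -
  have le: "face0 b \<le> supp b" "face1 b \<le> supp b" using assms(1) by (auto simp: Sing1_def)
  have "J P (nerve_pair x (supp b)) (J P (nerve_pair (supp b) (face0 b)) q)
      = J P (nerve_pair x (supp b)) (J P (nerve_pair (supp b) (face1 b)) p)"
    using assms le by (simp add: J_pair_comp)
  moreover have "J P (nerve_pair (supp b) (face0 b)) q \<in> fibre P (supp b)"
    "J P (nerve_pair (supp b) (face1 b)) p \<in> fibre P (supp b)"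
    using J_pair_bij le assms by (meson bij_betwE)+
  ultimately have "J P (nerve_pair (supp b) (face0 b)) q = J P (nerve_pair (supp b) (face1 b)) p"
    using J_pair_bij[OF assms(2)] by (auto simp: bij_betw_def dest: inj_onD)
  then show ?thesis
    unfolding flat_connection_def
    using J_pair_bij[OF le(1)] assms(4) by (metis bij_betw_inv_into_left)
qed

lemma flat_connection_props:
  assumes "b \<in> Sing1" "p \<in> fibre P (face1 b)"
  shows "flat_connection P b p \<in> fibre P (face0 b)"
    and "supp b \<le> x \<Longrightarrow>
      J P (nerve_pair x (face0 b)) (flat_connection P b p) = J P (nerve_pair x (face1 b)) p"
proof -
  have le: "face0 b \<le> supp b" "face1 b \<le> supp b" using assms(1) by (auto simp: Sing1_def)
  have m: "J P (nerve_pair (supp b) (face1 b)) p \<in> fibre P (supp b)"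
    using J_pair_bij[OF le(2)] assms by (meson bij_betwE)
  show f: "flat_connection P b p \<in> fibre P (face0 b)"
    unfolding flat_connection_def
    using J_pair_bij[OF le(1)] m by (metis bij_betw_def inv_into_into)
  have "J P (nerve_pair (supp b) (face0 b)) (flat_connection P b p)
      = J P (nerve_pair (supp b) (face1 b)) p"
    unfolding flat_connection_def
    using J_pair_bij[OF le(1)] m by (metis bij_betw_inv_into_right)
  then show "J P (nerve_pair x (face0 b)) (flat_connection P b p) = J P (nerve_pair x (face1 b)) p"
    if "supp b \<le> x"
    using that J_pair_comp[OF le(1) that f] J_pair_comp[OF le(2) that assms(2)] by metis
qed

lemma flat_connection_connection: "bundle_connection G P (flat_connection P)"
proof -
  have rev: "reverse1 b \<in> Sing1" "face0 (reverse1 b) = face1 b" "face1 (reverse1 b) = face0 b"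
    "supp (reverse1 b) = supp b" if "b \<in> Sing1" for b
    using that by (auto simp: Sing1_def reverse1_def)
  have inv1: "flat_connection P (reverse1 b) (flat_connection P b p) = p"
    if "b \<in> Sing1" "p \<in> fibre P (face1 b)" for b p
    using that rev[OF that(1)] flat_connection_props[OF that]
    by (intro flat_connection_eqI[where x = "supp b"]) auto
  have inv2: "flat_connection P b (flat_connection P (reverse1 b) p) = p"
    if "b \<in> Sing1" "p \<in> fibre P (face0 b)" for b p
    using that rev[OF that(1)] flat_connection_props[of "reverse1 b" p]
    by (intro flat_connection_eqI[where x = "supp b"]) auto
  have bij: "bij_betw (flat_connection P b) (fibre P (face1 b)) (fibre P (face0 b))"
    if "b \<in> Sing1" for b
    using that rev[OF that] inv1 inv2 flat_connection_props(1)
    by (intro bij_betwI[where g = "flat_connection P (reverse1 b)"]) (auto, metis)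
  have equiv: "flat_connection P b (act P p g) = act P (flat_connection P b p) g"
    if b: "b \<in> Sing1" and p: "p \<in> fibre P (face1 b)" and g: "g \<in> carrier G" for b p g
  proof -
    have n: "nerve_pair (supp b) (face0 b) \<in> Nerve1" "nerve_pair (supp b) (face1 b) \<in> Nerve1"
      using b by (auto simp: Nerve1_def Sing1_def)
    note f = flat_connection_props[OF b p]
    show ?thesis
      using f(1) f(2)[of "supp b"] J_act[OF n(1) _ g] J_act[OF n(2) _ g] b p g act_closed act_fibre
      by (intro flat_connection_eqI[where x = "supp b"])
        (auto simp: fibre_def nerve_pair_def)
  qed
  have inv: "flat_connection P (reverse1 b) p
      = inv_into (fibre P (face1 b)) (flat_connection P b) p"
    if "b \<in> Sing1" "p \<in> fibre P (face0 b)" for b p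
    using that bij[OF that(1)] inv2[OF that] flat_connection_props(1)[of "reverse1 b" p] rev[OF that(1)]
    by (metis bij_betw_inv_into_left)
  have ner: "flat_connection P b p = J P b p"
    if "b \<in> Nerve1" "p \<in> fibre P (face1 b)" for b p
  proof -
    obtain x a where b: "b = nerve_pair x a" "a \<le> x" using \<open>b \<in> Nerve1\<close> by (auto simp: Nerve1_def)
    have q: "J P b p \<in> fibre P x"
      using J_bij[OF that(1)] that(2) b by (auto simp: nerve_pair_def dest: bij_betwE)
    have "J P (nerve_pair x x) (J P b p) = J P b p"
      using J_degen[OF q] by (simp add: degen_def nerve_pair_def)
    then show ?thesis
      using b q that(2)
      by (intro flat_connection_eqI[where x = x]) (auto simp: Sing1_def nerve_pair_def)
  qed
  show ?thesis
    unfolding bundle_connection_def using bij equiv inv ner by blast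
qed

lemma flat_connection_flat: "flat P (flat_connection P)"
  unfolding flat_def
proof (intro ballI)
  fix c p
  assume c: "c \<in> Sing2" and p: "p \<in> fibre P (face1 (d1 c))"
  let ?J = "\<lambda>a. J P (nerve_pair (supp2 c) a)"
  let ?Z = "flat_connection P"
  have S: "d0 c \<in> Sing1" "d1 c \<in> Sing1" "d2 c \<in> Sing1"
    "supp (d0 c) \<le> supp2 c" "supp (d1 c) \<le> supp2 c" "supp (d2 c) \<le> supp2 c"
    "face0 (d0 c) = face0 (d1 c)" "face1 (d0 c) = face0 (d2 c)" "face1 (d1 c) = face1 (d2 c)"
    using c by (auto simp: Sing2_def)
  have p2: "p \<in> fibre P (face1 (d2 c))" using p S by simp
  have q: "?Z (d2 c) p \<in> fibre P (face1 (d0 c))"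
    using flat_connection_props(1)[OF S(3) p2] S by simp
  have "?J (face0 (d0 c)) (?Z (d0 c) (?Z (d2 c) p)) = ?J (face1 (d2 c)) p"
    using flat_connection_props(2)[OF S(1) q S(4)] flat_connection_props(2)[OF S(3) p2 S(6)] S
    by simp
  then show "?Z (d0 c) (?Z (d2 c) p) = ?Z (d1 c) p"
    using flat_connection_eqI[OF S(2) S(5) p, of "?Z (d0 c) (?Z (d2 c) p)"]
      flat_connection_props(1)[OF S(1) q] S by simp
qed

lemma flat_connection_unique:
  assumes U: "bundle_connection G P U" "flat P U" and b: "b \<in> Sing1"
    and p: "p \<in> fibre P (face1 b)"
  shows "U b p = flat_connection P b p"
proof -
  let ?c = "Simplex2 (supp b) (nerve_pair (supp b) (face0 b)) (nerve_pair (supp b) (face1 b)) b"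
  have n: "nerve_pair (supp b) (face0 b) \<in> Nerve1" "nerve_pair (supp b) (face1 b) \<in> Nerve1"
    using b by (auto simp: Nerve1_def Sing1_def)
  have c: "?c \<in> Sing2" using b by (auto simp: Sing2_def Sing1_def nerve_pair_def)
  have q: "U b p \<in> fibre P (face0 b)"
    using U(1) b p by (auto simp: bundle_connection_def dest: bij_betwE)
  have "U (nerve_pair (supp b) (face0 b)) (U b p) = U (nerve_pair (supp b) (face1 b)) p"
    using U(2) c p by (force simp: flat_def nerve_pair_def)
  moreover have "U (nerve_pair (supp b) (face0 b)) (U b p) = J P (nerve_pair (supp b) (face0 b)) (U b p)"
    "U (nerve_pair (supp b) (face1 b)) p = J P (nerve_pair (supp b) (face1 b)) p"
    using U(1) n q p by (auto simp: bundle_connection_def nerve_pair_def)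
  ultimately show ?thesis
    using flat_connection_eqI[OF b order_refl p q] by simp
qed

end

text \<open>\<open>conn_equiv G Q W P U\<close> is \<open>W \<cong> U\<close> for \<open>W\<close> on \<open>Q\<close> and \<open>U\<close> on \<open>P\<close>.\<close>

definition conn_equiv ::
  "('g, 'm) monoid_scheme \<Rightarrow> ('k::order, 'g, 'q) net_bundle \<Rightarrow> ('k simplex1 \<Rightarrow> 'q \<Rightarrow> 'q)
     \<Rightarrow> ('k, 'g, 'p) net_bundle \<Rightarrow> ('k simplex1 \<Rightarrow> 'p \<Rightarrow> 'p) \<Rightarrow> bool" where
  "conn_equiv G Q W P U \<longleftrightarrow> (\<exists>f. bundle_morphism G Q P f \<and>
     (\<forall>b \<in> Sing1. \<forall>x \<in> fibre Q (face1 b). f (W b x) = U b (f x)))"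

section \<open>Local trivializations and cochains\<close>

definition upset :: "'k::order \<Rightarrow> 'k set" where
  "upset a = {x. a \<le> x}"

definition local_trivialization ::
  "('g, 'm) monoid_scheme \<Rightarrow> ('k::order, 'g, 'p) net_bundle \<Rightarrow> ('k \<Rightarrow> 'k \<times> 'g \<Rightarrow> 'p) \<Rightarrow> bool" where
  "local_trivialization G P \<theta> \<longleftrightarrow> (\<forall>a.
     bij_betw (\<theta> a) (upset a \<times> carrier G) {x \<in> total_space P. proj P x \<in> upset a} \<and>
     (\<forall>x \<in> upset a. \<forall>g \<in> carrier G. proj P (\<theta> a (x, g)) = x) \<and>
     (\<forall>x \<in> upset a. \<forall>g \<in> carrier G. \<forall>h \<in> carrier G.
        \<theta> a (x, g \<otimes>\<^bsub>G\<^esub> h) = act P (\<theta> a (x, g)) h) \<and>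
     (\<forall>b \<in> Nerve1. face0 b \<in> upset a \<and> face1 b \<in> upset a \<longrightarrow>
        (\<forall>g \<in> carrier G. J P b (\<theta> a (face1 b, g)) = \<theta> a (face0 b, g))))"

definition connection_cochain ::
  "('g, 'm) monoid_scheme \<Rightarrow> ('k::order \<Rightarrow> 'k \<times> 'g \<Rightarrow> 'p) \<Rightarrow> ('k simplex1 \<Rightarrow> 'p \<Rightarrow> 'p)
     \<Rightarrow> 'k simplex1 \<Rightarrow> 'g" where
  "connection_cochain G \<theta> U b = (THE h. h \<in> carrier G \<and> (\<forall>g \<in> carrier G.
     (face0 b, h \<otimes>\<^bsub>G\<^esub> g) =
       inv_into (upset (face0 b) \<times> carrier G) (\<theta> (face0 b)) (U b (\<theta> (face1 b) (face1 b, g)))))"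

definition bundle_cocycle ::
  "('g, 'm) monoid_scheme \<Rightarrow> ('k::order, 'g, 'p) net_bundle \<Rightarrow> ('k \<Rightarrow> 'k \<times> 'g \<Rightarrow> 'p)
     \<Rightarrow> 'k simplex1 \<Rightarrow> 'g" where
  "bundle_cocycle G P \<theta> = connection_cochain G \<theta> (flat_connection P)"

section \<open>Reconstruction of a bundle from a cocycle\<close>

definition recon_rel ::
  "('g, 'm) monoid_scheme \<Rightarrow> ('k::order simplex1 \<Rightarrow> 'g) \<Rightarrow> (('k \<times> 'g \<times> 'k) \<times> ('k \<times> 'g \<times> 'k)) set"
  where
  "recon_rel G z = {((x, g, a), (x1, g1, a1)). g \<in> carrier G \<and> g1 \<in> carrier G \<and>
     x = x1 \<and> x \<in> upset a \<inter> upset a1 \<and> g = z (Simplex1 x a a1) \<otimes>\<^bsub>G\<^esub> g1}"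

definition recon_class ::
  "('g, 'm) monoid_scheme \<Rightarrow> ('k::order simplex1 \<Rightarrow> 'g) \<Rightarrow> 'k \<times> 'g \<times> 'k \<Rightarrow> ('k \<times> 'g \<times> 'k) set"
  where
  "recon_class G z t = recon_rel G z `` {t}"

text \<open>Operations on classes are written as unions over representatives: for a cocycle \<open>z\<close>, all
  representatives of a class contribute the same value.\<close>

definition recon_bundle ::
  "('g, 'm) monoid_scheme \<Rightarrow> ('k::order simplex1 \<Rightarrow> 'g) \<Rightarrow> ('k, 'g, ('k \<times> 'g \<times> 'k) set) net_bundle"
  where
  "recon_bundle G z = \<lparr>
     total_space = {(x, g, a) | x g a. x \<in> upset a \<and> g \<in> carrier G} // recon_rel G z,
     proj = (\<lambda>c. the_elem (fst ` c)),
     J = (\<lambda>b c. \<Union>((\<lambda>(x, g, a). recon_class G z (face0 b, g, a)) ` c)),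
     act = (\<lambda>c h. \<Union>((\<lambda>(x, g, a). recon_class G z (x, g \<otimes>\<^bsub>G\<^esub> h, a)) ` c))\<rparr>"

definition recon_triv ::
  "('g, 'm) monoid_scheme \<Rightarrow> ('k::order simplex1 \<Rightarrow> 'g) \<Rightarrow> 'k \<Rightarrow> 'k \<times> 'g \<Rightarrow> ('k \<times> 'g \<times> 'k) set"
  where
  "recon_triv G z a = (\<lambda>(x, g). recon_class G z (x, g, a))"

text \<open>The operator \<open>\<Upsilon>\<^sub>\<theta>\<close>, sending a cochain \<open>u\<close> to a connection.\<close>

definition cochain_connection ::
  "('g, 'm) monoid_scheme \<Rightarrow> ('k::order \<Rightarrow> 'k \<times> 'g \<Rightarrow> 'p) \<Rightarrow> ('k simplex1 \<Rightarrow> 'g)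
     \<Rightarrow> 'k simplex1 \<Rightarrow> 'p \<Rightarrow> 'p" where
  "cochain_connection G \<theta> u b y = \<theta> (face0 b)
     (face0 b, u b \<otimes>\<^bsub>G\<^esub> inv_into (carrier G) (\<lambda>g. \<theta> (face1 b) (face1 b, g)) y)"

section \<open>Reducibility\<close>

text \<open>Bundles with structure group a subgroup \<open>H\<close> of \<open>G\<close> are principal net bundles for
  \<open>G\<lparr>carrier := H\<rparr>\<close>. As \<open>H\<close> and \<open>G\<close> share the element type, the inclusion of \<open>H\<close> into \<open>G\<close> is
  the identity on elements.\<close>

definition connection_reducible ::
  "('g, 'm) monoid_scheme \<Rightarrow> ('k::order, 'g, 'p) net_bundle \<Rightarrow> ('k simplex1 \<Rightarrow> 'p \<Rightarrow> 'p)
     \<Rightarrow> 'g set \<Rightarrow> ('k, 'g, 'q) net_bundle \<Rightarrow> ('k simplex1 \<Rightarrow> 'q \<Rightarrow> 'q) \<Rightarrow> bool" where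
  "connection_reducible G P U H Q W \<longleftrightarrow>
     (\<exists>\<phi>. local_trivialization (G\<lparr>carrier := H\<rparr>) Q \<phi> \<and>
       (let z = bundle_cocycle (G\<lparr>carrier := H\<rparr>) Q \<phi>;
            u = connection_cochain (G\<lparr>carrier := H\<rparr>) \<phi> W
        in conn_equiv G (recon_bundle G z) (cochain_connection G (recon_triv G z) u) P U))"

definition bundle_reducible ::
  "('g, 'm) monoid_scheme \<Rightarrow> ('k::order, 'g, 'p) net_bundle
     \<Rightarrow> 'g set \<Rightarrow> ('k, 'g, 'q) net_bundle \<Rightarrow> bool" where
  "bundle_reducible G P H Q \<longleftrightarrow>
     (\<exists>W. bundle_connection (G\<lparr>carrier := H\<rparr>) Q W \<and>
          connection_reducible G P (flat_connection P) H Q W)"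

end

theory Submission
  imports Defs
begin

text \<open>The points of \<open>P\<close> that \<open>U\<close>-transport along paths reaches from \<open>\<psi>\<close> form a bundle \<open>Q\<close> with structure
  group \<open>H\<^sub>U(\<psi>)\<close> that is stable under \<open>U\<close>, hence under \<open>J\<close>. The inclusion of \<open>Q\<close> in \<open>P\<close> is
  \<open>H\<^sub>U(\<psi>)\<close>-equivariant and intertwines the restriction of \<open>U\<close> with \<open>U\<close>, and the flat connection of
  \<open>Q\<close> with that of \<open>P\<close>. An equivariant map from an \<open>H\<close>-bundle with these properties extends to the
  \<open>G\<close>-bundle reconstructed from its cocycle, which is reducibility.\<close>

section \<open>Free transitive actions and the trivializations given by points in the fibres\<close>

context principal_net_bundle
begin

lemma fibre_act: "x \<in> fibre P a \<Longrightarrow> g \<in> carrier G \<Longrightarrow> act P x g \<in> fibre P a"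
  by (simp add: fibre_def act_closed act_fibre)

lemma fibre_transitive:
  "x \<in> fibre P a \<Longrightarrow> y \<in> fibre P a \<Longrightarrow> \<exists>g \<in> carrier G. y = act P x g"
  by (auto simp: fibre_def intro: act_transitive)

text \<open>\<open>act_free\<close> speaks of stabilizers only, so both sides are moved by
  \<open>inv h\<close>: then \<open>g \<otimes> inv h\<close> fixes \<open>x\<close>.\<close>

lemma act_cancel:
  assumes "x \<in> total_space P" "g \<in> carrier G" "h \<in> carrier G" "act P x g = act P x h"
  shows "g = h"
proof -
  have "act P x (g \<otimes> inv h) = act P (act P x h) (inv h)"
    using assms act_mult by simp
  also have "\<dots> = x"
    using assms act_mult[of x h "inv h"] act_one by simp
  finally have "g \<otimes> inv h = \<one>"
    using act_free assms by simp
  then show ?thesis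
    using assms inv_equality[of g "inv h"] by simp
qed

lemma J_pair_fibre: "a \<le> x \<Longrightarrow> p \<in> fibre P a \<Longrightarrow> J P (nerve_pair x a) p \<in> fibre P x"
  using J_pair_bij by (meson bij_betwE)

lemma J_pair_refl: "p \<in> fibre P a \<Longrightarrow> J P (nerve_pair a a) p = p"
  using J_degen by (simp add: degen_def nerve_pair_def)

lemma J_pair_act:
  "a \<le> x \<Longrightarrow> p \<in> fibre P a \<Longrightarrow> g \<in> carrier G \<Longrightarrow>
    J P (nerve_pair x a) (act P p g) = act P (J P (nerve_pair x a) p) g"
  using J_act[of "nerve_pair x a" p g] by (auto simp: Nerve1_def nerve_pair_def)

lemma fibre_nonempty: "\<exists>x. x \<in> fibre P a"
  using proj_surj by (auto simp: fibre_def) (metis UNIV_I image_iff)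

text \<open>A choice of one point \<open>s a\<close> per fibre fixes a section over each
  \<open>upset a\<close>, spread out from \<open>s a\<close> by \<open>J\<close>. Coordinates are
  taken relative to this section.\<close>

definition triv_from :: "('k \<Rightarrow> 'p) \<Rightarrow> 'k \<Rightarrow> 'k \<times> 'g \<Rightarrow> 'p" where
  "triv_from s a = (\<lambda>(x, g). act P (J P (nerve_pair x a) (s a)) g)"

lemma triv_from_fibre:
  "(\<And>a. s a \<in> fibre P a) \<Longrightarrow> a \<le> x \<Longrightarrow> g \<in> carrier G \<Longrightarrow> triv_from s a (x, g) \<in> fibre P x"
  by (simp add: triv_from_def fibre_act J_pair_fibre)

text \<open>The base point is read off by the projection and the group element by freeness of the
  action; transitivity on the fibres gives surjectivity.\<close>

lemma triv_from_bij:
  assumes s: "\<And>a. s a \<in> fibre P a"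
  shows "bij_betw (triv_from s a) (upset a \<times> carrier G) {x \<in> total_space P. proj P x \<in> upset a}"
  unfolding bij_betw_def
proof
  show "inj_on (triv_from s a) (upset a \<times> carrier G)"
  proof (rule inj_onI, clarsimp simp: upset_def)
    fix x g y h
    assume xy: "a \<le> x" "a \<le> y" and gh: "g \<in> carrier G" "h \<in> carrier G"
      and e: "triv_from s a (x, g) = triv_from s a (y, h)"
    have "x = y"
      using triv_from_fibre[OF s xy(1) gh(1)] triv_from_fibre[OF s xy(2) gh(2)] e
      by (simp add: fibre_def)
    moreover have "J P (nerve_pair x a) (s a) \<in> total_space P"
      using J_pair_fibre[OF xy(1) s] by (simp add: fibre_def)
    ultimately show "x = y \<and> g = h"
      using e gh by (auto simp: triv_from_def intro: act_cancel)
  qed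
  show "triv_from s a ` (upset a \<times> carrier G) = {x \<in> total_space P. proj P x \<in> upset a}"
  proof (intro equalityI subsetI)
    fix y assume "y \<in> triv_from s a ` (upset a \<times> carrier G)"
    then show "y \<in> {x \<in> total_space P. proj P x \<in> upset a}"
      using triv_from_fibre[of s, OF s] by (force simp: upset_def fibre_def)
  next
    fix y assume y: "y \<in> {x \<in> total_space P. proj P x \<in> upset a}"
    then have "a \<le> proj P y" "y \<in> fibre P (proj P y)" by (auto simp: upset_def fibre_def)
    then obtain g where "g \<in> carrier G" "y = act P (J P (nerve_pair (proj P y) a) (s a)) g"
      using fibre_transitive J_pair_fibre s by blast
    with y show "y \<in> triv_from s a ` (upset a \<times> carrier G)"
      by (intro image_eqI[where x = "(proj P y, g)"]) (auto simp: triv_from_def)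
  qed
qed

lemma local_trivialization_triv_from:
  assumes s: "\<And>a. s a \<in> fibre P a"
  shows "local_trivialization G P (triv_from s)"
  unfolding local_trivialization_def
proof (intro allI conjI ballI impI)
  fix a
  show "bij_betw (triv_from s a) (upset a \<times> carrier G) {x \<in> total_space P. proj P x \<in> upset a}"
    using s by (rule triv_from_bij)
  fix x g assume x: "x \<in> upset a" and g: "g \<in> carrier G"
  show "proj P (triv_from s a (x, g)) = x"
    using triv_from_fibre[OF s, of a x g] x g by (simp add: upset_def fibre_def)
  fix h assume "h \<in> carrier G"
  then show "triv_from s a (x, g \<otimes> h) = act P (triv_from s a (x, g)) h"
    using x g J_pair_fibre[OF _ s, of a x] by (simp add: triv_from_def upset_def fibre_def act_mult)
next
  fix a and b :: "'k simplex1" and g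
  assume b: "b \<in> Nerve1" "face0 b \<in> upset a \<and> face1 b \<in> upset a" and g: "g \<in> carrier G"
  then obtain x y where "b = nerve_pair y x" "x \<le> y" "a \<le> x" "face1 b = x" "face0 b = y"
    by (auto simp: Nerve1_def upset_def nerve_pair_def)
  then show "J P b (triv_from s a (face1 b, g)) = triv_from s a (face0 b, g)"
    using s g by (simp add: triv_from_def J_pair_act J_pair_fibre J_pair_comp)
qed

text \<open>This replaces \<open>THE\<close> and \<open>inv_into\<close> by a usable equation: the
  cochain compares the transported point \<open>U b (s (face1 b))\<close> with the chosen point over
  \<open>face0 b\<close>. Over \<open>a\<close> itself the chart is just
  \<open>act P (s a) g\<close>, because \<open>J\<close> is the identity on degenerate
  simplices.\<close>

lemma connection_cochain_triv_from:
  assumes U: "bundle_connection G P U" and s: "\<And>a. s a \<in> fibre P a" and b: "b \<in> Sing1"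
  shows "connection_cochain G (triv_from s) U b \<in> carrier G"
    and "U b (s (face1 b)) = act P (s (face0 b)) (connection_cochain G (triv_from s) U b)"
proof -
  let ?u = "connection_cochain G (triv_from s) U b"
  have Us: "U b (s (face1 b)) \<in> fibre P (face0 b)"
    using U b s by (auto simp: bundle_connection_def dest: bij_betwE)
  have triv: "triv_from s a (a, g) = act P (s a) g" for a g
    using s by (simp add: triv_from_def J_pair_refl)
  obtain h where h: "h \<in> carrier G" "U b (s (face1 b)) = act P (s (face0 b)) h"
    using fibre_transitive[OF s Us] by blast
  have inv_h: "inv_into (upset (face0 b) \<times> carrier G) (triv_from s (face0 b))
      (U b (triv_from s (face1 b) (face1 b, g))) = (face0 b, h \<otimes> g)" if g: "g \<in> carrier G" for g
  proof -
    have "U b (triv_from s (face1 b) (face1 b, g)) = act P (U b (s (face1 b))) g"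
      using U b g s by (simp add: triv bundle_connection_def)
    also have "\<dots> = triv_from s (face0 b) (face0 b, h \<otimes> g)"
      using h g s[of "face0 b"] by (simp add: triv act_mult fibre_def)
    finally show ?thesis
      using triv_from_bij[OF s, of "face0 b"] h(1) g
      by (auto simp: bij_betw_def upset_def intro: inv_into_f_eq)
  qed
  have "?u = h"
    unfolding connection_cochain_def
  proof (rule the_equality)
    show "h \<in> carrier G \<and> (\<forall>g\<in>carrier G. (face0 b, h \<otimes> g) =
      inv_into (upset (face0 b) \<times> carrier G) (triv_from s (face0 b))
        (U b (triv_from s (face1 b) (face1 b, g))))"
      using h(1) inv_h by simp
  next
    fix k assume k: "k \<in> carrier G \<and> (\<forall>g\<in>carrier G. (face0 b, k \<otimes> g) =
      inv_into (upset (face0 b) \<times> carrier G) (triv_from s (face0 b))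
        (U b (triv_from s (face1 b) (face1 b, g))))"
    \<comment> \<open>Evaluation at the unit already determines the element.\<close>
    then have "(face0 b, k \<otimes> \<one>) = (face0 b, h \<otimes> \<one>)"
      using inv_h[OF one_closed] one_closed by metis
    then show "k = h" using k h(1) by simp
  qed
  with h show "?u \<in> carrier G" "U b (s (face1 b)) = act P (s (face0 b)) ?u" by auto
qed

end

section \<open>Equivariant maps of bundles and reducibility\<close>

lemma morphism_flat_connection:
  assumes P: "principal_net_bundle G P" and Q: "principal_net_bundle H Q"
    and f: "bundle_morphism H Q P f" and b: "b \<in> Sing1" and x: "x \<in> fibre Q (face1 b)"
  shows "f (flat_connection Q b x) = flat_connection P b (f x)"
proof -
  interpret P: principal_net_bundle G P by fact
  interpret Q: principal_net_bundle H Q by fact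
  have fib: "f y \<in> fibre P a" if "y \<in> fibre Q a" for y a
    using f that by (auto simp: bundle_morphism_def fibre_def)
  have nerve: "nerve_pair (supp b) (face0 b) \<in> Nerve1" "nerve_pair (supp b) (face1 b) \<in> Nerve1"
    using b by (auto simp: Nerve1_def Sing1_def)
  have J: "J P (nerve_pair (supp b) a) (f y) = f (J Q (nerve_pair (supp b) a) y)"
    if "y \<in> fibre Q a" "nerve_pair (supp b) a \<in> Nerve1" for y a
    using f that unfolding bundle_morphism_def by (simp add: nerve_pair_def)
  note Z = Q.flat_connection_props[OF b x]
  \<comment> \<open>The flat connection is characterized by its image under \<open>J\<close> into
    the fibre over \<open>supp b\<close>, and \<open>f\<close> commutes with
    \<open>J\<close>.\<close>
  have "flat_connection P b (f x) = f (flat_connection Q b x)"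
    by (rule P.flat_connection_eqI[OF b order_refl fib[OF x] fib[OF Z(1)]])
      (simp add: J nerve x Z)
  then show ?thesis by simp
qed

text \<open>For points \<open>s a\<close> in the fibres of \<open>Q\<close>, the morphism from the reconstructed \<open>G\<close>-bundle to \<open>P\<close>
  sends the class \<open>[x, g, a]\<close> to \<open>f (J(x, a) (s a)) \<cdot> g\<close>; the reconstruction relation is exactly
  the kernel of this map.\<close>

lemma connection_reducible_if_conn_equiv:
  fixes G :: "('g, 'm) monoid_scheme" and P :: "('k::order, 'g, 'p) net_bundle"
    and Q :: "('k, 'g, 'q) net_bundle"
  assumes P: "principal_net_bundle G P" and U: "bundle_connection G P U"
    and H: "subgroup H G" and Q: "principal_net_bundle (G\<lparr>carrier := H\<rparr>) Q"
    and W: "bundle_connection (G\<lparr>carrier := H\<rparr>) Q W"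
    and eqv: "conn_equiv (G\<lparr>carrier := H\<rparr>) Q W P U"
  shows "connection_reducible G P U H Q W"
proof -
  let ?H = "G\<lparr>carrier := H\<rparr>"
  interpret P: principal_net_bundle G P by fact
  interpret Q: principal_net_bundle ?H Q by fact
  obtain f where f: "bundle_morphism ?H Q P f"
    and fW: "\<And>b x. b \<in> Sing1 \<Longrightarrow> x \<in> fibre Q (face1 b) \<Longrightarrow> f (W b x) = U b (f x)"
    using eqv by (auto simp: conn_equiv_def)
  have f_fibre: "f x \<in> fibre P a" if "x \<in> fibre Q a" for x a
    using f that by (auto simp: bundle_morphism_def fibre_def)
  have f_act: "f (act Q x h) = act P (f x) h" if "x \<in> fibre Q a" "h \<in> H" for x h a
    using f that by (auto simp: bundle_morphism_def fibre_def)
  have f_J: "f (J Q (nerve_pair y a) x) = J P (nerve_pair y a) (f x)"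
    if "x \<in> fibre Q a" "a \<le> y" for x y a
  proof -
    have "nerve_pair y a \<in> Nerve1" using that by (auto simp: Nerve1_def)
    then show ?thesis
      using f that(1) unfolding bundle_morphism_def by (metis nerve_pair_def simplex1.sel(3))
  qed
  \<comment> \<open>Reducibility asks for some trivialization of \<open>Q\<close>; the one given by
    an arbitrary choice of points serves.\<close>
  obtain s where s: "\<And>a. s a \<in> fibre Q a" using Q.fibre_nonempty by metis
  define \<phi> where "\<phi> = Q.triv_from s"
  define z where "z = bundle_cocycle ?H Q \<phi>"
  define u where "u = connection_cochain ?H \<phi> W"
  have HG: "h \<in> carrier G" if "h \<in> H" for h using H that by (rule subgroup.mem_carrier)
  have u: "u b \<in> H" "W b (s (face1 b)) = act Q (s (face0 b)) (u b)" if "b \<in> Sing1" for b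
    using Q.connection_cochain_triv_from[where s = s and U = W, OF W s that] by (simp_all add: u_def \<phi>_def)
  have z: "z b \<in> H" "flat_connection Q b (s (face1 b)) = act Q (s (face0 b)) (z b)"
    if "b \<in> Sing1" for b
    using Q.connection_cochain_triv_from[where s = s, OF Q.flat_connection_connection s that]
    by (simp_all add: z_def \<phi>_def bundle_cocycle_def)
  \<comment> \<open>\<open>E\<close> is the desired morphism on representatives, and
    \<open>D\<close> is the set of representatives.\<close>
  define t where "t x a = f (J Q (nerve_pair x a) (s a))" for x a
  define E where "E = (\<lambda>(x, g, a). act P (t x a) g)"
  define D where "D = {(x, g, a) | (x::'k) g a. x \<in> upset a \<and> g \<in> carrier G}"
  have t_fibre: "t x a \<in> fibre P x" if "a \<le> x" for x a
    using that s by (simp add: t_def f_fibre Q.J_pair_fibre)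
  have t_refl: "t a a = f (s a)" for a using s by (simp add: t_def Q.J_pair_refl)
  \<comment> \<open>Over \<open>x\<close>, the sections started at \<open>a\<close> and
    \<open>a1\<close> differ by the value of the cocycle on \<open>(x; a, a1)\<close>, since
    \<open>J\<close> into the fibre over \<open>x\<close> turns the defining property of the flat
    connection into this comparison.\<close>
  have t_z: "t x a1 = act P (t x a) (z (Simplex1 x a a1))" if "a \<le> x" "a1 \<le> x" for x a a1
  proof -
    let ?b = "Simplex1 x a a1"
    have b: "?b \<in> Sing1" using that by (simp add: Sing1_def)
    have "J Q (nerve_pair x a1) (s a1) = J Q (nerve_pair x a) (act Q (s a) (z ?b))"
      using Q.flat_connection_props(2)[OF b, of "s a1" x] z(2)[OF b] s by simp
    also have "\<dots> = act Q (J Q (nerve_pair x a) (s a)) (z ?b)"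
      using Q.J_pair_act that s z(1)[OF b] by simp
    finally show ?thesis
      using f_act[OF Q.J_pair_fibre[OF that(1) s] z(1)[OF b]] by (simp add: t_def)
  qed
  \<comment> \<open>By \<open>t_z\<close> and freeness, equality under \<open>E\<close> is the
    relation of the cocycle. Well-definedness of the operations on classes thereby becomes a
    computation with \<open>E\<close>.\<close>
  have rel: "recon_rel G z = {(p, q). p \<in> D \<and> q \<in> D \<and> fst p = fst q \<and> E p = E q}"
  proof -
    have "act P (t x a) g = act P (t x a1) g1 \<longleftrightarrow> g = z (Simplex1 x a a1) \<otimes>\<^bsub>G\<^esub> g1"
      if "a \<le> x" "a1 \<le> x" "g \<in> carrier G" "g1 \<in> carrier G" for x a a1 g g1
    proof -
      have zG: "z (Simplex1 x a a1) \<in> carrier G" using z(1) that by (simp add: HG Sing1_def)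
      have "act P (t x a1) g1 = act P (t x a) (z (Simplex1 x a a1) \<otimes>\<^bsub>G\<^esub> g1)"
        using t_z[OF that(1,2)] t_fibre[OF that(1)] zG that by (simp add: P.act_mult fibre_def)
      then show ?thesis
        using P.act_cancel[of "t x a" g "z (Simplex1 x a a1) \<otimes>\<^bsub>G\<^esub> g1"] t_fibre[OF that(1)] zG that
        by (auto simp: fibre_def)
    qed
    then show ?thesis by (auto simp: recon_rel_def D_def E_def upset_def)
  qed
  let ?R = "recon_bundle G z"
  let ?C = "recon_class G z"
  have C: "?C p = {q \<in> D. fst q = fst p \<and> E q = E p}" if "p \<in> D" for p
    using that by (auto simp: recon_class_def rel)
  have C_eq: "?C p = ?C q" if "p \<in> D" "q \<in> D" "fst p = fst q" "E p = E q" for p q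
    using that by (simp add: C)
  have self: "p \<in> ?C p" if "p \<in> D" for p using that by (simp add: C)
  \<comment> \<open>A union over representatives collapses to one value when they all contribute the
    same class.\<close>
  have UN: "\<Union>(h ` ?C p) = h p" if "p \<in> D" "\<And>q. q \<in> ?C p \<Longrightarrow> h q = h p"
    for p and h :: "_ \<Rightarrow> ('k \<times> 'g \<times> 'k) set"
    using self[OF that(1)] by (intro SUP_eq_const that(2)) blast+
  have total: "total_space ?R = ?C ` D"
    by (auto simp: recon_bundle_def quotient_def recon_class_def D_def)
  have proj: "proj ?R (?C p) = fst p" if "p \<in> D" for p
  proof -
    have "fst ` ?C p = {fst p}" using that self[OF that] by (auto simp: C)
    then show ?thesis by (simp add: recon_bundle_def)
  qed
  have E_fibre: "E (x, g, a) \<in> fibre P x" if "(x, g, a) \<in> D" for x g a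
    using that by (auto simp: D_def E_def upset_def t_fibre P.fibre_act)
  have J: "J ?R b (?C (x, g, a)) = ?C (face0 b, g, a)"
    and EJ: "E (face0 b, g, a) = J P b (E (x, g, a))" and DJ: "(face0 b, g, a) \<in> D"
    if d: "(x, g, a) \<in> D" and b: "b \<in> Nerve1" "face1 b = x" for x g a b
  proof -
    obtain y where y: "b = nerve_pair y x" "x \<le> y" "face0 b = y"
      using b by (auto simp: Nerve1_def nerve_pair_def)
    \<comment> \<open>Stated for all representatives over \<open>x\<close>, so that the
      contributions to the union defining \<open>J ?R\<close> can be compared through
      \<open>E\<close>.\<close>
    have D': "(y, g', a') \<in> D" if "(x, g', a') \<in> D" for g' a'
      using that y by (auto simp: D_def upset_def)
    have E': "E (y, g', a') = J P b (E (x, g', a'))" if "(x, g', a') \<in> D" for g' a'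
    proof -
      from that have a': "a' \<le> x" "g' \<in> carrier G" by (auto simp: D_def upset_def)
      have "J P b (t x a') = t y a'"
        using y a' s f_J[OF Q.J_pair_fibre[OF a'(1) s] y(2)] by (simp add: t_def Q.J_pair_comp)
      then show ?thesis
        using y a' P.J_pair_act[OF y(2) t_fibre[OF a'(1)] a'(2)] by (simp add: E_def)
    qed
    show "(face0 b, g, a) \<in> D" "E (face0 b, g, a) = J P b (E (x, g, a))" using D' E' d y by auto
    have "?C (face0 b, g', a') = ?C (face0 b, g, a)" if "(x', g', a') \<in> ?C (x, g, a)" for x' g' a'
      using that d C y by (intro C_eq) (auto simp: D' E')
    then have "(case q of (x, g, a) \<Rightarrow> ?C (face0 b, g, a))
        = (case (x, g, a) of (x, g, a) \<Rightarrow> ?C (face0 b, g, a))"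
      if "q \<in> ?C (x, g, a)" for q using that by (cases q) simp
    from UN[where h = "\<lambda>(x, g, a). ?C (face0 b, g, a)", OF d this] show "J ?R b (?C (x, g, a)) = ?C (face0 b, g, a)"
      by (simp add: recon_bundle_def)
  qed
  have act: "act ?R (?C (x, g, a)) h = ?C (x, g \<otimes>\<^bsub>G\<^esub> h, a)"
    and Eact: "E (x, g \<otimes>\<^bsub>G\<^esub> h, a) = act P (E (x, g, a)) h" and Dact: "(x, g \<otimes>\<^bsub>G\<^esub> h, a) \<in> D"
    if d: "(x, g, a) \<in> D" and h: "h \<in> carrier G" for x g a h
  proof -
    have D': "(x', g' \<otimes>\<^bsub>G\<^esub> h, a') \<in> D" if "(x', g', a') \<in> D" for x' g' a'
      using that h by (auto simp: D_def)
    have E': "E (x', g' \<otimes>\<^bsub>G\<^esub> h, a') = act P (E (x', g', a')) h" if "(x', g', a') \<in> D" for x' g' a'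
      using that h t_fibre by (auto simp: D_def E_def upset_def fibre_def P.act_mult)
    show "(x, g \<otimes>\<^bsub>G\<^esub> h, a) \<in> D" "E (x, g \<otimes>\<^bsub>G\<^esub> h, a) = act P (E (x, g, a)) h"
      using D' E' d by auto
    have "?C (x', g' \<otimes>\<^bsub>G\<^esub> h, a') = ?C (x, g \<otimes>\<^bsub>G\<^esub> h, a)" if "(x', g', a') \<in> ?C (x, g, a)" for x' g' a'
      using that d C by (intro C_eq) (auto simp: D' E')
    then have "(case q of (x, g, a) \<Rightarrow> ?C (x, g \<otimes>\<^bsub>G\<^esub> h, a))
        = (case (x, g, a) of (x, g, a) \<Rightarrow> ?C (x, g \<otimes>\<^bsub>G\<^esub> h, a))"
      if "q \<in> ?C (x, g, a)" for q using that by (cases q) simp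
    from UN[where h = "\<lambda>(x, g, a). ?C (x, g \<otimes>\<^bsub>G\<^esub> h, a)", OF d this]
    show "act ?R (?C (x, g, a)) h = ?C (x, g \<otimes>\<^bsub>G\<^esub> h, a)"
      by (simp add: recon_bundle_def)
  qed
  \<comment> \<open>\<open>E\<close> is constant on each class, so the image is a singleton.\<close>
  define F where "F c = the_elem (E ` c)" for c
  have F: "F (?C p) = E p" if "p \<in> D" for p
  proof -
    have "E ` ?C p = {E p}" using that self[OF that] by (auto simp: C)
    then show ?thesis by (simp add: F_def)
  qed
  have mor: "bundle_morphism G ?R P F"
    unfolding bundle_morphism_def
  proof (intro conjI ballI funcsetI)
    fix c assume "c \<in> total_space ?R"
    then obtain x g a where c: "c = ?C (x, g, a)" and d: "(x, g, a) \<in> D"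
      unfolding total by (metis imageE prod_cases3)
    show "F c \<in> total_space P" "proj P (F c) = proj ?R c"
      using E_fibre[OF d] F[OF d] proj[OF d] by (auto simp: c fibre_def)
    fix h assume h: "h \<in> carrier G"
    show "F (act ?R c h) = act P (F c) h"
      using act[OF d h] Eact[OF d h] F[OF Dact[OF d h]] F[OF d] by (simp add: c)
  next
    fix b c assume b: "b \<in> Nerve1" and "c \<in> fibre ?R (face1 b)"
    then obtain x g a where c: "c = ?C (x, g, a)" and d: "(x, g, a) \<in> D"
      and p: "proj ?R c = face1 b"
      unfolding fibre_def total by (smt (verit, best) image_iff mem_Collect_eq prod_cases3)
    then have x: "face1 b = x" using proj[OF d] by simp
    show "J P b (F c) = F (J ?R b c)"
      using J[OF d b x] EJ[OF d b x] F[OF DJ[OF d b x]] F[OF d] by (simp add: c)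
  qed
  have conn: "F (cochain_connection G (recon_triv G z) u b c) = U b (F c)"
    if b: "b \<in> Sing1" and c: "c \<in> fibre ?R (face1 b)" for b c
  proof -
    let ?x = "face1 b"
    obtain x g' a where c': "c = ?C (x, g', a)" and d': "(x, g', a) \<in> D" and p: "proj ?R c = ?x"
      using c unfolding fibre_def total by (smt (verit, best) image_iff mem_Collect_eq prod_cases3)
    then have x: "x = ?x" using proj[OF d'] by simp
    have Dx: "(y, k, y) \<in> D" if "k \<in> carrier G" for y k using that by (simp add: D_def upset_def)
    have s1: "f (s y) \<in> fibre P y" for y using s f_fibre by blast
    \<comment> \<open>Every class over \<open>face1 b\<close> also has a representative in the chart
      at \<open>face1 b\<close>, the chart in which the connection of a cochain is written.\<close>
    obtain g where g: "g \<in> carrier G" "E (x, g', a) = E (?x, g, ?x)"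
      using P.fibre_transitive[OF s1 E_fibre[OF d']] x by (auto simp: E_def t_refl)
    have cg: "c = ?C (?x, g, ?x)"
      unfolding c' using d' Dx[OF g(1)] x g(2) by (intro C_eq) auto
    \<comment> \<open>Needed to evaluate the \<open>inv_into\<close> by which
      \<open>cochain_connection\<close> recovers the group coordinate.\<close>
    have inj: "inj_on (\<lambda>g. recon_triv G z ?x (?x, g)) (carrier G)"
    proof (rule inj_onI)
      fix k l assume kl: "k \<in> carrier G" "l \<in> carrier G"
        and "recon_triv G z ?x (?x, k) = recon_triv G z ?x (?x, l)"
      then have "E (?x, k, ?x) = E (?x, l, ?x)"
        using F[OF Dx] by (metis recon_triv_def case_prod_conv)
      then show "k = l"
        using P.act_cancel[of "f (s ?x)"] kl s1[of ?x] by (simp add: E_def t_refl fibre_def)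
    qed
    have ug: "u b \<in> carrier G" using u(1)[OF b] by (rule HG)
    have "cochain_connection G (recon_triv G z) u b c = ?C (face0 b, u b \<otimes>\<^bsub>G\<^esub> g, face0 b)"
      using inv_into_f_f[OF inj g(1)] by (simp add: cochain_connection_def cg recon_triv_def)
    then have "F (cochain_connection G (recon_triv G z) u b c)
        = act P (f (s (face0 b))) (u b \<otimes>\<^bsub>G\<^esub> g)"
      using F[OF Dx] ug g(1) by (simp add: E_def t_refl)
    \<comment> \<open>The cochain \<open>u\<close> is absorbed into transport by \<open>W\<close>;
      then \<open>f\<close> exchanges \<open>W\<close> for \<open>U\<close>, and equivariance of
      \<open>U\<close> absorbs \<open>g\<close>.\<close>
    also have "\<dots> = act P (f (W b (s ?x))) g"
      using u[OF b] s1[of "face0 b"] f_act[OF s] ug g(1) by (simp add: P.act_mult fibre_def)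
    also have "\<dots> = U b (act P (f (s ?x)) g)"
      using fW[OF b s] U b s1[of ?x] g(1) by (simp add: bundle_connection_def)
    also have "\<dots> = U b (F c)"
      using F[OF Dx] g(1) by (simp add: cg E_def t_refl)
    finally show ?thesis .
  qed
  have "conn_equiv G ?R (cochain_connection G (recon_triv G z) u) P U"
    unfolding conn_equiv_def using mor conn by blast
  moreover have "local_trivialization ?H Q \<phi>"
    unfolding \<phi>_def using s by (rule Q.local_trivialization_triv_from)
  ultimately show ?thesis
    unfolding connection_reducible_def Let_def z_def u_def by blast
qed

text \<open>A morphism automatically intertwines the flat connections, so the flat connection of
  \<open>Q\<close> is the required witness.\<close>

lemma bundle_reducible_if_morphism:
  assumes "principal_net_bundle G P" "subgroup H G" "principal_net_bundle (G\<lparr>carrier := H\<rparr>) Q"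
    and f: "bundle_morphism (G\<lparr>carrier := H\<rparr>) Q P f"
  shows "bundle_reducible G P H Q"
proof -
  interpret P: principal_net_bundle G P by fact
  interpret Q: principal_net_bundle "G\<lparr>carrier := H\<rparr>" Q by fact
  have "conn_equiv (G\<lparr>carrier := H\<rparr>) Q (flat_connection Q) P (flat_connection P)"
    using f morphism_flat_connection[OF assms(1,3) f] by (auto simp: conn_equiv_def)
  then have "connection_reducible G P (flat_connection P) H Q (flat_connection Q)"
    using connection_reducible_if_conn_equiv[OF assms(1) P.flat_connection_connection assms(2,3)]
      Q.flat_connection_connection by blast
  then show ?thesis
    unfolding bundle_reducible_def using Q.flat_connection_connection by blast
qed

section \<open>Transport of points along paths\<close>

lemma Nerve1_subset_Sing1: "Nerve1 \<subseteq> Sing1"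
  by (auto simp: Nerve1_def Sing1_def nerve_pair_def)

lemma is_path_Cons:
  "is_path (b # p) \<longleftrightarrow> b \<in> Sing1 \<and> (p = [] \<or> is_path p \<and> face0 b = path_source p)"
  by (auto simp: is_path_def path_source_def nth_Cons hd_conv_nth split: nat.splits)

locale net_bundle_connection = principal_net_bundle G P
  for G :: "('g, 'm) monoid_scheme" (structure) and P :: "('k::order, 'g, 'p) net_bundle" +
  fixes U :: "'k simplex1 \<Rightarrow> 'p \<Rightarrow> 'p"
  assumes conn: "bundle_connection G P U"
begin

lemma U_bij: "b \<in> Sing1 \<Longrightarrow> bij_betw (U b) (fibre P (face1 b)) (fibre P (face0 b))"
  using conn by (simp add: bundle_connection_def)

lemma U_fibre: "b \<in> Sing1 \<Longrightarrow> x \<in> fibre P (face1 b) \<Longrightarrow> U b x \<in> fibre P (face0 b)"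
  using U_bij by (meson bij_betwE)

lemma U_act:
  "b \<in> Sing1 \<Longrightarrow> x \<in> fibre P (face1 b) \<Longrightarrow> g \<in> carrier G \<Longrightarrow> U b (act P x g) = act P (U b x) g"
  using conn by (simp add: bundle_connection_def)

lemma U_reverse: "b \<in> Sing1 \<Longrightarrow> x \<in> fibre P (face1 b) \<Longrightarrow> U (reverse1 b) (U b x) = x"
  using conn U_fibre bij_betw_inv_into_left[OF U_bij] by (simp add: bundle_connection_def)

lemma U_eq_J: "b \<in> Nerve1 \<Longrightarrow> x \<in> fibre P (face1 b) \<Longrightarrow> U b x = J P b x"
  using conn by (simp add: bundle_connection_def)

text \<open>As a relation on points, concatenation of paths becomes transitivity of the closure and
  reversal becomes symmetry.\<close>

definition transport_step :: "('p \<times> 'p) set" where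
  "transport_step = {(x, U b x) | b x. b \<in> Sing1 \<and> x \<in> fibre P (face1 b)}"

definition transported :: "'p \<Rightarrow> 'p set" where
  "transported x = transport_step\<^sup>* `` {x}"

lemma transport_stepI: "b \<in> Sing1 \<Longrightarrow> x \<in> fibre P (face1 b) \<Longrightarrow> (x, U b x) \<in> transport_step"
  by (auto simp: transport_step_def)

text \<open>Each step is retraced by the reversed simplex. Hence reachability is an equivalence
  relation, with \<open>transported \<psi>\<close> the class of \<open>\<psi>\<close>.\<close>

lemma sym_transport: "sym (transport_step\<^sup>*)"
proof (intro sym_rtrancl symI)
  fix x y assume "(x, y) \<in> transport_step"
  then obtain b where b: "b \<in> Sing1" "x \<in> fibre P (face1 b)" "y = U b x"
    by (auto simp: transport_step_def)
  then have "reverse1 b \<in> Sing1" "y \<in> fibre P (face1 (reverse1 b))"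
    using U_fibre by (auto simp: Sing1_def reverse1_def)
  then show "(y, x) \<in> transport_step"
    using transport_stepI[of "reverse1 b" y] U_reverse b by simp
qed

text \<open>Equivariance of \<open>U\<close> translates a whole chain of steps by \<open>g\<close>;
  this is the source of the group structure on the holonomy.\<close>

lemma transport_act:
  assumes "(x, y) \<in> transport_step\<^sup>*" "g \<in> carrier G"
  shows "(act P x g, act P y g) \<in> transport_step\<^sup>*"
  using assms(1)
proof induction
  case (step y z)
  then obtain b where b: "b \<in> Sing1" "y \<in> fibre P (face1 b)" "z = U b y"
    by (auto simp: transport_step_def)
  then have "(act P y g, act P z g) \<in> transport_step"
    using transport_stepI[of b "act P y g"] fibre_act U_act assms(2) by simp
  with step show ?case by simp
qed simp

lemma transport_total: "(x, y) \<in> transport_step\<^sup>* \<Longrightarrow> x \<in> total_space P \<Longrightarrow> y \<in> total_space P"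
  by (induction rule: rtrancl_induct) (auto simp: transport_step_def dest: U_fibre simp: fibre_def)

lemma path_transport_step:
  "is_path p \<Longrightarrow> x \<in> fibre P (path_source p) \<Longrightarrow>
    (x, path_transport U p x) \<in> transport_step\<^sup>* \<and> path_transport U p x \<in> fibre P (path_target p)"
proof (induction p arbitrary: x)
  case Nil
  then show ?case by (simp add: is_path_def)
next
  case (Cons b p)
  then have b: "b \<in> Sing1" "x \<in> fibre P (face1 b)" and p: "p = [] \<or> is_path p \<and> face0 b = path_source p"
    by (auto simp: is_path_Cons path_source_def)
  note s = transport_stepI[OF b] U_fibre[OF b]
  show ?case
  proof (cases "p = []")
    case True
    then show ?thesis using s by (auto simp: path_transport_def path_target_def)
  next
    case False
    then have "(U b x, path_transport U p (U b x)) \<in> transport_step\<^sup>*"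
      "path_transport U p (U b x) \<in> fibre P (path_target p)"
      using p s Cons.IH by auto
    with False s(1) show ?thesis
      by (auto simp: path_transport_def path_target_def intro: converse_rtrancl_into_rtrancl)
  qed
qed

text \<open>Paths are non-empty lists, hence \<open>trancl\<close>. Lists follow the order of
  traversal, so the induction prepends a simplex at the source.\<close>

lemma transport_path:
  assumes "(x, y) \<in> transport_step\<^sup>+"
  shows "\<exists>p. is_path p \<and> path_source p = proj P x \<and> path_target p = proj P y \<and>
    path_transport U p x = y"
  using assms
proof (induction rule: converse_trancl_induct)
  case (base x)
  then obtain b where "b \<in> Sing1" "x \<in> fibre P (face1 b)" "y = U b x"
    by (auto simp: transport_step_def)
  then show ?case
    using U_fibre[of b x]
    by (intro exI[of _ "[b]"])
      (auto simp: is_path_Cons path_source_def path_target_def path_transport_def fibre_def)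
next
  case (step x x')
  then obtain b where b: "b \<in> Sing1" "x \<in> fibre P (face1 b)" "x' = U b x"
    by (auto simp: transport_step_def)
  obtain p where "is_path p" "path_source p = proj P x'" "path_target p = proj P y"
    "path_transport U p x' = y" using step by blast
  moreover from this have "p \<noteq> []" by (simp add: is_path_def)
  ultimately show ?case
    using b U_fibre[of b x]
    by (intro exI[of _ "b # p"])
      (auto simp: is_path_Cons path_source_def path_target_def path_transport_def fibre_def)
qed

text \<open>The degenerate simplex is a step that fixes \<open>x\<close>; it stands in for the empty
  path.\<close>

lemma transport_step_refl: "x \<in> total_space P \<Longrightarrow> (x, x) \<in> transport_step"
proof -
  assume "x \<in> total_space P"
  then have x: "x \<in> fibre P (proj P x)" by (simp add: fibre_def)
  have n: "degen (proj P x) \<in> Nerve1" by (auto simp: Nerve1_def degen_def nerve_pair_def)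
  have "U (degen (proj P x)) x = x"
    using U_eq_J[OF n, of x] J_degen[OF x] x by (simp add: degen_def)
  then show ?thesis
    using transport_stepI[of "degen (proj P x)" x] n Nerve1_subset_Sing1 x by (auto simp: degen_def)
qed

section \<open>The holonomy group as the elements keeping a point reachable\<close>

lemma holonomy_group_eq:
  assumes \<psi>: "\<psi> \<in> total_space P"
  shows "holonomy_group G P U \<psi> = {g \<in> carrier G. act P \<psi> g \<in> transported \<psi>}"
proof (intro equalityI subsetI)
  fix g assume "g \<in> holonomy_group G P U \<psi>"
  then show "g \<in> {g \<in> carrier G. act P \<psi> g \<in> transported \<psi>}"
    using \<psi> path_transport_step by (auto simp: holonomy_group_def transported_def fibre_def)
next
  fix g assume "g \<in> {g \<in> carrier G. act P \<psi> g \<in> transported \<psi>}"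
  then have g: "g \<in> carrier G" "(\<psi>, act P \<psi> g) \<in> transport_step\<^sup>*" by (auto simp: transported_def)
  then have "(\<psi>, act P \<psi> g) \<in> transport_step\<^sup>+"
    using transport_step_refl[OF \<psi>] by (metis rtrancl_into_trancl2)
  then show "g \<in> holonomy_group G P U \<psi>"
    \<comment> \<open>The path found is a loop because the action preserves the fibre of
      \<open>\<psi>\<close>.\<close>
    using transport_path[of \<psi> "act P \<psi> g"] act_fibre[OF \<psi> g(1)] g(1)
    by (auto simp: holonomy_group_def)
qed

text \<open>Write \<open>~\<close> for reachability. Translating \<open>\<psi> ~ \<psi>g\<close> by
  \<open>inv g\<close> gives inverses; translating it by \<open>h\<close> and prepending
  \<open>\<psi> ~ \<psi>h\<close> gives products.\<close>

lemma subgroup_holonomy: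
  assumes \<psi>: "\<psi> \<in> total_space P"
  shows "subgroup (holonomy_group G P U \<psi>) G"
proof (rule subgroupI)
  note eq = holonomy_group_eq[OF \<psi>]
  show "holonomy_group G P U \<psi> \<subseteq> carrier G" by (auto simp: eq)
  have "\<one> \<in> holonomy_group G P U \<psi>" using act_one[OF \<psi>] by (auto simp: eq transported_def)
  then show "holonomy_group G P U \<psi> \<noteq> {}" by blast
next
  fix g assume "g \<in> holonomy_group G P U \<psi>"
  then have g: "g \<in> carrier G" "(\<psi>, act P \<psi> g) \<in> transport_step\<^sup>*"
    by (auto simp: holonomy_group_eq[OF \<psi>] transported_def)
  have "(act P \<psi> (inv g), act P (act P \<psi> g) (inv g)) \<in> transport_step\<^sup>*"
    using g by (intro transport_act) auto
  also have "act P (act P \<psi> g) (inv g) = \<psi>"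
    using act_mult[OF \<psi>, of g "inv g"] act_one[OF \<psi>] g by simp
  finally show "inv g \<in> holonomy_group G P U \<psi>"
    using g sym_transport by (auto simp: holonomy_group_eq[OF \<psi>] transported_def dest: symD)
next
  fix g h assume "g \<in> holonomy_group G P U \<psi>" "h \<in> holonomy_group G P U \<psi>"
  then have g: "g \<in> carrier G" "(\<psi>, act P \<psi> g) \<in> transport_step\<^sup>*"
    and h: "h \<in> carrier G" "(\<psi>, act P \<psi> h) \<in> transport_step\<^sup>*"
    by (auto simp: holonomy_group_eq[OF \<psi>] transported_def)
  have "(\<psi>, act P \<psi> (g \<otimes> h)) \<in> transport_step\<^sup>*"
    using transport_act[OF g(2) h(1)] h(2) act_mult[OF \<psi>] g(1) h(1) by (simp add: rtrancl_trans)
  then show "g \<otimes> h \<in> holonomy_group G P U \<psi>"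
    using g h by (simp add: holonomy_group_eq[OF \<psi>] transported_def)
qed

section \<open>The bundle of reachable points\<close>

definition holonomy_bundle :: "'p \<Rightarrow> ('k, 'g, 'p) net_bundle" where
  "holonomy_bundle \<psi> = P\<lparr>total_space := transported \<psi>\<rparr>"

lemma holonomy_bundle_simps [simp]:
  "total_space (holonomy_bundle \<psi>) = transported \<psi>" "proj (holonomy_bundle \<psi>) = proj P"
  "J (holonomy_bundle \<psi>) = J P" "act (holonomy_bundle \<psi>) = act P"
  by (simp_all add: holonomy_bundle_def)

text \<open>Only the total space shrinks. The maps of \<open>P\<close> are kept as functions, since
  the bundle conditions evaluate them at points of the total space alone.\<close>

lemma fibre_holonomy_bundle:
  "\<psi> \<in> total_space P \<Longrightarrow> fibre (holonomy_bundle \<psi>) a = fibre P a \<inter> transported \<psi>"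
  using transport_total by (auto simp: fibre_def transported_def)

text \<open>The converse direction retraces \<open>b\<close>; it makes the restricted transports
  surjective between the smaller fibres.\<close>

lemma U_transported:
  "b \<in> Sing1 \<Longrightarrow> x \<in> fibre P (face1 b) \<Longrightarrow> U b x \<in> transported \<psi> \<longleftrightarrow> x \<in> transported \<psi>"
  unfolding transported_def using transport_stepI[of b x] sym_transport
  by (metis Image_singleton_iff r_into_rtrancl rtrancl_trans symD)

text \<open>Since \<open>x\<close> and \<open>\<psi>\<close> reach each other, so do their
  translates by \<open>g\<close>. The holonomy group is thus the stabilizer of the reachable set,
  which yields both closure and transitivity of its action.\<close>

lemma transported_act_iff:
  assumes \<psi>: "\<psi> \<in> total_space P" and x: "x \<in> transported \<psi>" and g: "g \<in> carrier G"
  shows "act P x g \<in> transported \<psi> \<longleftrightarrow> g \<in> holonomy_group G P U \<psi>"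
  using transport_act[of \<psi> x g] x g sym_transport
  by (simp add: holonomy_group_eq[OF \<psi>] transported_def) (metis rtrancl_trans symD)

lemma U_bij_holonomy:
  assumes "\<psi> \<in> total_space P" "b \<in> Sing1"
  shows "bij_betw (U b) (fibre (holonomy_bundle \<psi>) (face1 b)) (fibre (holonomy_bundle \<psi>) (face0 b))"
  using U_bij[OF assms(2)] U_transported[OF assms(2)]
  unfolding fibre_holonomy_bundle[OF assms(1)] bij_betw_def inj_on_def by blast

lemma principal_holonomy_bundle:
  assumes conn_K: "pathwise_connected TYPE('k)" and \<psi>: "\<psi> \<in> total_space P"
  shows "principal_net_bundle (G\<lparr>carrier := holonomy_group G P U \<psi>\<rparr>) (holonomy_bundle \<psi>)"
proof -
  let ?H = "holonomy_group G P U \<psi>"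
  interpret H: group "G\<lparr>carrier := ?H\<rparr>"
    using subgroup_holonomy[OF \<psi>] is_group by (rule subgroup.subgroup_is_group)
  have H: "h \<in> carrier G" if "h \<in> ?H" for h using that by (simp add: holonomy_group_def)
  have T: "x \<in> total_space P" if "x \<in> transported \<psi>" for x
    using that transport_total \<psi> by (simp add: transported_def)
  \<comment> \<open>On the nerve \<open>U\<close> is \<open>J\<close>, so the reachable set is also
    stable under \<open>J\<close>.\<close>
  have eq: "U b x = J P b x" if "b \<in> Nerve1" "x \<in> fibre (holonomy_bundle \<psi>) (face1 b)" for b x
    using that U_eq_J fibre_holonomy_bundle[OF \<psi>] by simp
  show ?thesis
  proof unfold_locales
    show "proj (holonomy_bundle \<psi>) ` total_space (holonomy_bundle \<psi>) = UNIV"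
    proof (intro equalityI subsetI)
      fix a :: 'k
      \<comment> \<open>Connectedness enters here: transport of \<open>\<psi>\<close> along
        \<open>p\<close> gives a reachable point over \<open>a\<close>.\<close>
      obtain p where "is_path p" "path_source p = proj P \<psi>" "path_target p = a"
        using conn_K by (auto simp: pathwise_connected_def)
      then show "a \<in> proj (holonomy_bundle \<psi>) ` total_space (holonomy_bundle \<psi>)"
        using path_transport_step[of p \<psi>] \<psi> by (force simp: fibre_def transported_def)
    qed simp
  next
    fix b :: "'k simplex1" assume b: "b \<in> Nerve1"
    then have "bij_betw (U b) (fibre (holonomy_bundle \<psi>) (face1 b)) (fibre (holonomy_bundle \<psi>) (face0 b))"
      using U_bij_holonomy \<psi> Nerve1_subset_Sing1 by blast
    then show "bij_betw (J (holonomy_bundle \<psi>) b)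
        (fibre (holonomy_bundle \<psi>) (face1 b)) (fibre (holonomy_bundle \<psi>) (face0 b))"
      using bij_betw_cong[of _ "U b" "J P b", OF eq[OF b]] by simp
  next
    fix x y assume xy: "x \<in> total_space (holonomy_bundle \<psi>)" "y \<in> total_space (holonomy_bundle \<psi>)"
      "proj (holonomy_bundle \<psi>) x = proj (holonomy_bundle \<psi>) y"
    \<comment> \<open>The element of \<open>G\<close> moving \<open>x\<close> to \<open>y\<close>
      lies in the holonomy group because \<open>y\<close> is reachable.\<close>
    then obtain g where "g \<in> carrier G" "y = act P x g" using act_transitive[of x y] T by auto
    then show "\<exists>g\<in>carrier (G\<lparr>carrier := ?H\<rparr>). y = act (holonomy_bundle \<psi>) x g"
      using transported_act_iff[OF \<psi>, of x g] xy by auto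
  qed (auto simp: fibre_holonomy_bundle[OF \<psi>] T H J_comp J_degen transported_act_iff[OF \<psi>]
      act_one act_mult act_fibre J_act dest: act_free[OF T H])
qed

lemma connection_holonomy_bundle:
  assumes \<psi>: "\<psi> \<in> total_space P"
  shows "bundle_connection (G\<lparr>carrier := holonomy_group G P U \<psi>\<rparr>) (holonomy_bundle \<psi>) U"
proof -
  \<comment> \<open>The inverse is now taken over a smaller fibre, but the preimage of
    \<open>x\<close> under \<open>U b\<close> already lies in it.\<close>
  have "U (reverse1 b) x = inv_into (fibre (holonomy_bundle \<psi>) (face1 b)) (U b) x"
    if b: "b \<in> Sing1" and x: "x \<in> fibre (holonomy_bundle \<psi>) (face0 b)" for b x
  proof -
    note bij = U_bij_holonomy[OF \<psi> b]
    obtain y where y: "y \<in> fibre (holonomy_bundle \<psi>) (face1 b)" "x = U b y"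
      using bij x by (auto simp: bij_betw_def)
    then show ?thesis
      using U_reverse[OF b, of y] bij
      by (simp add: fibre_holonomy_bundle[OF \<psi>] bij_betw_inv_into_left)
  qed
  then show ?thesis
    unfolding bundle_connection_def using U_bij_holonomy[OF \<psi>]
    by (auto simp: fibre_holonomy_bundle[OF \<psi>] U_act U_eq_J holonomy_group_def)
qed

lemma morphism_holonomy_bundle:
  assumes "\<psi> \<in> total_space P"
  shows "bundle_morphism (G\<lparr>carrier := holonomy_group G P U \<psi>\<rparr>) (holonomy_bundle \<psi>) P (\<lambda>x. x)"
  using transport_total assms by (auto simp: bundle_morphism_def transported_def)

end

theorem theorem7p7:
  fixes G :: "('g, 'm) monoid_scheme"
    and P :: "('k::order, 'g, 'p) net_bundle"
    and U :: "'k simplex1 \<Rightarrow> 'p \<Rightarrow> 'p"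
    and \<psi> :: 'p
  assumes "pathwise_connected TYPE('k)"
    and "group G"
    and "principal_net_bundle G P"
    and "\<psi> \<in> total_space P"
    and "bundle_connection G P U"
  shows "\<exists>Q :: ('k, 'g, 'p) net_bundle.
    principal_net_bundle (G\<lparr>carrier := holonomy_group G P U \<psi>\<rparr>) Q \<and>
    bundle_reducible G P (holonomy_group G P U \<psi>) Q \<and>
    (\<exists>W. bundle_connection (G\<lparr>carrier := holonomy_group G P U \<psi>\<rparr>) Q W \<and>
         connection_reducible G P U (holonomy_group G P U \<psi>) Q W)"
proof -
  interpret net_bundle_connection G P U
    using assms(3,5) by (simp add: net_bundle_connection_def net_bundle_connection_axioms_def)
  note \<psi> = assms(4)
  note Q = principal_holonomy_bundle[OF assms(1) \<psi>]
    and W = connection_holonomy_bundle[OF \<psi>]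
    and f = morphism_holonomy_bundle[OF \<psi>]
    and H = subgroup_holonomy[OF \<psi>]
  \<comment> \<open>The inclusion carries \<open>U\<close>, used as a connection on the smaller
    bundle, to \<open>U\<close> itself; the same bundle then serves both claims.\<close>
  have "conn_equiv (G\<lparr>carrier := holonomy_group G P U \<psi>\<rparr>) (holonomy_bundle \<psi>) U P U"
    using f by (auto simp: conn_equiv_def)
  then have "connection_reducible G P U (holonomy_group G P U \<psi>) (holonomy_bundle \<psi>) U"
    by (rule connection_reducible_if_conn_equiv[OF assms(3,5) H Q W])
  with bundle_reducible_if_morphism[OF assms(3) H Q f] Q W show ?thesis by blast
qed

end
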